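(* Let ${\cal C}$ be the class of graphs that can be obtained from a cycle by attaching an arbitrary number (possibly zero) of leaves to each of the vertices of the cycle. A graph $G\in{\cal C}$ is $4$-$\chi_\rho$-critical if and only if $G$ is (isomorphic to) one of the following graphs: (i) $G=C_n$ with $n\ge 5$, $n\not\equiv 0\pmod 4$; (ii) $G$ is the net graph; (iii) $G$ is obtained by attaching a single leaf to each of two adjacent vertices of $C_4$; (iv) $G$ is obtained by attaching a single leaf to each of two vertices at distance $3$ on $C_8$.
   Context: Graphs are finite, simple and undirected, with nonempty vertex set. Distance is shortest-path distance ($\infty$ between different components). For a positive integer $i$, an $i$-packing in $G$ is a set of vertices such that any two distinct vertices in it are at distance greater than $i$. The packing chromatic number $\chi_\rho(G)$ is the smallest integer $k$ such that $V(G)$ can be partitioned into (possibly empty) sets $V_1,\ldots,V_k$ with $V_i$ an $i$-packing for each $i\in\{1,\ldots,k\}$. $G-x$ denotes the graph obtained from $G$ by deleting the vertex $x$. A graph $G$ is $k$-$\chi_\rho$-critical if $\chi_\rho(G)=k$ and $\chi_\rho(G-x)<k$ for every vertex $x$ of $G$. $C_n$ denotes the cycle on $n\ge 3$ vertices. Attaching a leaf to a vertex $v$ means adding a new vertex adjacent only to $v$. The net graph is the graph obtained from $K_3$ by attaching a single leaf to each of its three vertices. *)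

theory Defs
  imports "HOL-Library.Extended_Nat" "HOL-Library.Disjoint_Sets"
begin

record 'a ugraph =
  verts :: "'a set"
  edges :: "'a set set"

definition simple_graph :: "'a ugraph \<Rightarrow> bool" where
  "simple_graph G \<longleftrightarrow> finite (verts G) \<and> verts G \<noteq> {} \<and>
     (\<forall>e\<in>edges G. e \<subseteq> verts G \<and> card e = 2)"

definition graph_iso :: "'a ugraph \<Rightarrow> 'b ugraph \<Rightarrow> bool" (infix "\<cong>\<^sub>g" 50) where
  "G \<cong>\<^sub>g H \<longleftrightarrow> (\<exists>f. bij_betw f (verts G) (verts H) \<and>
     (\<forall>u\<in>verts G. \<forall>v\<in>verts G. {u, v} \<in> edges G \<longleftrightarrow> {f u, f v} \<in> edges H))"

definition delete_vertex :: "'a ugraph \<Rightarrow> 'a \<Rightarrow> 'a ugraph" where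
  "delete_vertex G x = \<lparr>verts = verts G - {x}, edges = {e \<in> edges G. x \<notin> e}\<rparr>"


definition walk :: "'a ugraph \<Rightarrow> 'a list \<Rightarrow> bool" where
  "walk G p \<longleftrightarrow> p \<noteq> [] \<and> set p \<subseteq> verts G \<and> successively (\<lambda>u v. {u, v} \<in> edges G) p"

(* The infimum of the empty set is \<infinity> in enat, which covers vertices in
   different components. *)
definition gdist :: "'a ugraph \<Rightarrow> 'a \<Rightarrow> 'a \<Rightarrow> enat" where
  "gdist G u v = (INF p \<in> {p. walk G p \<and> hd p = u \<and> last p = v}. enat (length p - 1))"


definition packing :: "'a ugraph \<Rightarrow> nat \<Rightarrow> 'a set \<Rightarrow> bool" where
  "packing G i S \<longleftrightarrow> S \<subseteq> verts G \<and> (\<forall>u\<in>S. \<forall>v\<in>S. u \<noteq> v \<longrightarrow> gdist G u v > enat i)"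

definition packing_partition :: "'a ugraph \<Rightarrow> nat \<Rightarrow> (nat \<Rightarrow> 'a set) \<Rightarrow> bool" where
  "packing_partition G k P \<longleftrightarrow> (\<Union>i\<in>{1..k}. P i) = verts G \<and>
     disjoint_family_on P {1..k} \<and> (\<forall>i\<in>{1..k}. packing G i (P i))"

definition packing_chromatic_number :: "'a ugraph \<Rightarrow> nat" ("\<chi>\<^sub>\<rho>") where
  "\<chi>\<^sub>\<rho> G = (LEAST k. \<exists>P. packing_partition G k P)"

definition packing_critical :: "nat \<Rightarrow> 'a ugraph \<Rightarrow> bool" where
  "packing_critical k G \<longleftrightarrow>
     \<chi>\<^sub>\<rho> G = k \<and> (\<forall>x\<in>verts G. \<chi>\<^sub>\<rho> (delete_vertex G x) < k)"


definition complete_graph :: "nat \<Rightarrow> nat ugraph" where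
  "complete_graph n = \<lparr>verts = {..<n}, edges = {e. e \<subseteq> {..<n} \<and> card e = 2}\<rparr>"

(* Meaningful for n \<ge> 3 only. *)
definition cycle_graph :: "nat \<Rightarrow> nat ugraph" where
  "cycle_graph n = \<lparr>verts = {..<n}, edges = {{i, Suc i mod n} | i. i < n}\<rparr>"

(* Attach l v leaves to each vertex v of H. The pair (v, 0) is the original vertex v,
   and the pairs (v, j) with 1 \<le> j \<le> l v are the leaves attached to it. *)
definition attach_leaves :: "'a ugraph \<Rightarrow> ('a \<Rightarrow> nat) \<Rightarrow> ('a \<times> nat) ugraph" where
  "attach_leaves H l =
     \<lparr>verts = {(v, j). v \<in> verts H \<and> j \<le> l v},
      edges = {{(u, 0), (v, 0)} | u v. {u, v} \<in> edges H} \<union>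
              {{(v, 0), (v, j)} | v j. v \<in> verts H \<and> 1 \<le> j \<and> j \<le> l v}\<rparr>"

definition leafed_cycle :: "'a ugraph \<Rightarrow> bool" where
  "leafed_cycle G \<longleftrightarrow> (\<exists>n l. n \<ge> 3 \<and> G \<cong>\<^sub>g attach_leaves (cycle_graph n) l)"

definition net_graph :: "(nat \<times> nat) ugraph" where
  "net_graph = attach_leaves (complete_graph 3) (\<lambda>_. 1)"

end

theory Submission
  imports Defs
begin

text \<open>
  Criticality at 4 means that the graph is 4-colourable but not 3-colourable and that deleting any
  vertex makes it 3-colourable. Everything rests on the rigidity of packing colourings with three
  colours. If adjacent vertices have colours 2 and 3, a path can continue beyond the vertex of
  colour 2 by one vertex only (\<open>three_coloring_no_2_3\<close>). Hence along a path, away from its ends,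
  and along a whole cycle of length at least 4, every second vertex has colour 1
  (\<open>three_coloring_alternates\<close>), and on a cycle the other vertices alternate between 2 and 3, so that
  the length is divisible by 4. Moreover a vertex of degree at least 3 never has colour 1
  (\<open>three_coloring_degree_3\<close>). Thus a leafed cycle of length \<open>n \<ge> 4\<close> is 3-colourable if and only if
  4 divides \<open>n\<close> and one of the two parity classes carries no leaf
  (\<open>leafed_cycle_3_colorable_iff\<close>); a leafed triangle is 3-colourable if and only if one of its
  vertices carries no leaf.

  These criteria decide the effect of deleting a leaf. A critical leafed cycle is therefore a cycle
  without leaves, the net, or a cycle of length \<open>n\<close> divisible by 4 with exactly two leaves, at an odd
  distance \<open>d\<close> from each other. In the last case, if one of the arcs between the leafed vertices has
  length at most \<open>n - 6\<close>, then deleting a vertex outside this arc and at distance 3 from it leaves a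
  path on which both leafed vertices are away from the ends, and hence still cannot be 3-coloured
  (\<open>delete_far_cycle_vertex_not_3_colorable\<close>). Only \<open>n = 4\<close>, and \<open>n = 8\<close> with \<open>d = 3\<close>, escape this
  argument.

  Conversely, a 4-colouring in which \<open>w\<close> is the only vertex of colour 4 shows at once that the graph
  is 4-colourable and that deleting \<open>w\<close> leaves a 3-colourable graph, since deletion does not shorten
  distances. Such colourings are given for every vertex \<open>w\<close> of the cycle
  (\<open>leafed_cycle_criticalI\<close>). Leaves always receive colour 1, so that only distances along the cycle
  have to be estimated.
\<close>

section \<open>Packing colourings\<close>

definition packing_coloring :: "'a ugraph \<Rightarrow> nat \<Rightarrow> ('a \<Rightarrow> nat) \<Rightarrow> bool" where
  "packing_coloring G k c \<longleftrightarrow> (\<forall>v\<in>verts G. c v \<in> {1..k}) \<and>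
     (\<forall>u\<in>verts G. \<forall>v\<in>verts G. u \<noteq> v \<longrightarrow> c u = c v \<longrightarrow> enat (c u) < gdist G u v)"

definition packing_colorable :: "'a ugraph \<Rightarrow> nat \<Rightarrow> bool" where
  "packing_colorable G k \<longleftrightarrow> (\<exists>c. packing_coloring G k c)"

lemma packing_colorable_iff_partition:
  "packing_colorable G k \<longleftrightarrow> (\<exists>P. packing_partition G k P)"
proof
  assume "packing_colorable G k"
  then obtain c where "packing_coloring G k c"
    unfolding packing_colorable_def by blast
  then have "packing_partition G k (\<lambda>i. {v \<in> verts G. c v = i})"
    unfolding packing_coloring_def packing_partition_def disjoint_family_on_def packing_def
    by (auto; metis)
  then show "\<exists>P. packing_partition G k P" by blast
next
  assume "\<exists>P. packing_partition G k P"
  then obtain P where cover: "(\<Union>i\<in>{1..k}. P i) = verts G"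
    and pack: "\<And>i. i \<in> {1..k} \<Longrightarrow> packing G i (P i)"
    unfolding packing_partition_def by blast
  define c where "c v = (SOME i. i \<in> {1..k} \<and> v \<in> P i)" for v
  have c: "c v \<in> {1..k} \<and> v \<in> P (c v)" if "v \<in> verts G" for v
    unfolding c_def by (rule someI_ex) (use that cover in blast)
  have "packing_coloring G k c"
    unfolding packing_coloring_def
  proof (intro conjI ballI impI)
    fix u v assume uv: "u \<in> verts G" "v \<in> verts G" "u \<noteq> v" "c u = c v"
    then have "u \<in> P (c u)" "v \<in> P (c u)" "packing G (c u) (P (c u))"
      using c[of u] c[of v] pack by auto
    with \<open>u \<noteq> v\<close> show "enat (c u) < gdist G u v"
      unfolding packing_def by blast
  qed (use c in blast)
  then show "packing_colorable G k" unfolding packing_colorable_def by blast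
qed

lemma gdist_greater_iff:
  "enat i < gdist G u v \<longleftrightarrow>
     (\<forall>p. walk G p \<longrightarrow> hd p = u \<longrightarrow> last p = v \<longrightarrow> i < length p - 1)"
proof -
  have "enat i < gdist G u v \<longleftrightarrow> eSuc (enat i) \<le> gdist G u v"
    by (cases "gdist G u v") (auto simp: eSuc_enat)
  also have "\<dots> \<longleftrightarrow> (\<forall>p. walk G p \<longrightarrow> hd p = u \<longrightarrow> last p = v \<longrightarrow> i < length p - 1)"
    unfolding gdist_def by (auto simp: le_INF_iff eSuc_enat Suc_le_eq)
  finally show ?thesis .
qed

lemma packing_colorable_mono:
  assumes "packing_colorable G k" "k \<le> k'"
  shows "packing_colorable G k'"
  using assms unfolding packing_colorable_def packing_coloring_def
  by (metis atLeastAtMost_iff order_trans)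

lemma finite_imp_packing_colorable:
  assumes "finite (verts G)"
  shows "\<exists>k. packing_colorable G k"
proof -
  obtain f where f: "bij_betw f (verts G) {0..<card (verts G)}"
    using ex_bij_betw_finite_nat[OF assms] by blast
  have "packing_coloring G (card (verts G)) (\<lambda>v. Suc (f v))"
    unfolding packing_coloring_def
    using bij_betwE[OF f] bij_betw_imp_inj_on[OF f] by (fastforce simp: inj_on_def)
  then show ?thesis unfolding packing_colorable_def by blast
qed

text \<open>Finiteness ensures that there is a colouring at all, without which the least number of colours
  would be an arbitrary value.\<close>

lemma packing_chromatic_number_le_iff:
  assumes "finite (verts G)"
  shows "\<chi>\<^sub>\<rho> G \<le> k \<longleftrightarrow> packing_colorable G k"
proof -
  have eq: "\<chi>\<^sub>\<rho> G = (LEAST k. packing_colorable G k)"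
    unfolding packing_chromatic_number_def packing_colorable_iff_partition ..
  show ?thesis
    using LeastI_ex[OF finite_imp_packing_colorable[OF assms]] packing_colorable_mono
      Least_le[of "packing_colorable G" k]
    unfolding eq by blast
qed

lemma finite_delete_vertex: "finite (verts G) \<Longrightarrow> finite (verts (delete_vertex G x))"
  by (simp add: delete_vertex_def)

lemma packing_critical_4_iff:
  assumes "finite (verts G)"
  shows "packing_critical 4 G \<longleftrightarrow> \<not> packing_colorable G 3 \<and> packing_colorable G 4 \<and>
     (\<forall>x\<in>verts G. packing_colorable (delete_vertex G x) 3)"
proof -
  have "\<chi>\<^sub>\<rho> G = 4 \<longleftrightarrow> \<not> \<chi>\<^sub>\<rho> G \<le> 3 \<and> \<chi>\<^sub>\<rho> G \<le> 4" by auto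
  moreover have "n < 4 \<longleftrightarrow> n \<le> 3" for n :: nat by auto
  ultimately show ?thesis
    unfolding packing_critical_def
    by (simp add: packing_chromatic_number_le_iff assms finite_delete_vertex)
qed

text \<open>Injective homomorphisms do not increase distances, so colourings pull back along them.\<close>

lemma packing_colorable_pullback:
  assumes "packing_colorable H k"
    and inj: "inj_on f (verts G)" and V: "f ` verts G \<subseteq> verts H"
    and E: "\<And>u v. \<lbrakk>u \<in> verts G; v \<in> verts G; {u, v} \<in> edges G\<rbrakk> \<Longrightarrow> {f u, f v} \<in> edges H"
  shows "packing_colorable G k"
proof -
  obtain c where c: "packing_coloring H k c"
    using assms(1) unfolding packing_colorable_def by blast
  have walk: "walk H (map f p)" if "walk G p" for p
    using that V unfolding walk_def
    by (auto simp: successively_map intro: E elim!: successively_mono)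
  have "packing_coloring G k (c \<circ> f)"
    unfolding packing_coloring_def
  proof (intro conjI ballI impI)
    fix u v assume uv: "u \<in> verts G" "v \<in> verts G" "u \<noteq> v" "(c \<circ> f) u = (c \<circ> f) v"
    then have "f u \<in> verts H" "f v \<in> verts H" "f u \<noteq> f v"
      using V inj by (auto simp: inj_on_def)
    with uv c have "enat (c (f u)) < gdist H (f u) (f v)"
      unfolding packing_coloring_def by auto
    then show "enat ((c \<circ> f) u) < gdist G u v"
      using walk unfolding gdist_greater_iff
      by (metis comp_apply hd_map last_map length_map walk_def)
  qed (use c V in \<open>auto simp: packing_coloring_def\<close>)
  then show ?thesis unfolding packing_colorable_def by blast
qed

lemma graph_iso_sym: "G \<cong>\<^sub>g H \<Longrightarrow> H \<cong>\<^sub>g G"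
  unfolding graph_iso_def
proof (elim exE conjE)
  fix f assume f: "bij_betw f (verts G) (verts H)"
    and E: "\<forall>u\<in>verts G. \<forall>v\<in>verts G. ({u, v} \<in> edges G) = ({f u, f v} \<in> edges H)"
  let ?g = "the_inv_into (verts G) f"
  have "bij_betw ?g (verts H) (verts G)" using f by (rule bij_betw_the_inv_into)
  moreover have "f (?g u) = u" "?g u \<in> verts G" if "u \<in> verts H" for u
    using f that calculation
    by (auto simp: bij_betw_def f_the_inv_into_f)
  ultimately show "\<exists>f. bij_betw f (verts H) (verts G) \<and>
      (\<forall>u\<in>verts H. \<forall>v\<in>verts H. ({u, v} \<in> edges H) = ({f u, f v} \<in> edges G))"
    using E by (intro exI[of _ ?g]) auto
qed

lemma graph_iso_trans: "G \<cong>\<^sub>g H \<Longrightarrow> H \<cong>\<^sub>g K \<Longrightarrow> G \<cong>\<^sub>g K"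
  unfolding graph_iso_def
proof (elim exE conjE)
  fix f g assume *: "bij_betw f (verts G) (verts H)"
    "\<forall>u\<in>verts G. \<forall>v\<in>verts G. ({u, v} \<in> edges G) = ({f u, f v} \<in> edges H)"
    "bij_betw g (verts H) (verts K)"
    "\<forall>u\<in>verts H. \<forall>v\<in>verts H. ({u, v} \<in> edges H) = ({g u, g v} \<in> edges K)"
  show "\<exists>f. bij_betw f (verts G) (verts K) \<and>
      (\<forall>u\<in>verts G. \<forall>v\<in>verts G. ({u, v} \<in> edges G) = ({f u, f v} \<in> edges K))"
    using * bij_betwE[OF *(1)]
    by (intro exI[of _ "g \<circ> f"] conjI bij_betw_trans[of f _ "verts H"]) auto
qed

lemma packing_colorable_iso:
  assumes "G \<cong>\<^sub>g H" "packing_colorable H k"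
  shows "packing_colorable G k"
proof -
  obtain f where f: "bij_betw f (verts G) (verts H)"
    "\<forall>u\<in>verts G. \<forall>v\<in>verts G. ({u, v} \<in> edges G) = ({f u, f v} \<in> edges H)"
    using assms(1) unfolding graph_iso_def by blast
  show ?thesis
    by (rule packing_colorable_pullback[OF assms(2), of f])
      (use f in \<open>auto simp: bij_betw_def\<close>)
qed

lemma delete_vertex_iso:
  assumes "bij_betw f (verts G) (verts H)"
    and "\<forall>u\<in>verts G. \<forall>v\<in>verts G. {u, v} \<in> edges G \<longleftrightarrow> {f u, f v} \<in> edges H"
    and "x \<in> verts G"
  shows "delete_vertex G x \<cong>\<^sub>g delete_vertex H (f x)"
proof -
  have "bij_betw f (verts G - {x}) (verts H - {f x})"
    using assms(1,3) by (auto simp: bij_betw_def inj_on_def)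
  moreover have "f x \<noteq> f u" if "u \<in> verts G" "u \<noteq> x" for u
    using bij_betw_imp_inj_on[OF assms(1)] assms(3) that by (metis inj_onD)
  ultimately show ?thesis
    unfolding graph_iso_def delete_vertex_def using assms(2)
    by (intro exI[of _ f]) auto
qed

lemma packing_critical_iso_imp:
  assumes iso: "G \<cong>\<^sub>g H" and fin: "finite (verts G)" and crit: "packing_critical 4 G"
  shows "packing_critical 4 H"
proof -
  obtain f where f: "bij_betw f (verts G) (verts H)"
    "\<forall>u\<in>verts G. \<forall>v\<in>verts G. ({u, v} \<in> edges G) = ({f u, f v} \<in> edges H)"
    using iso unfolding graph_iso_def by blast
  have finH: "finite (verts H)" using f(1) fin by (simp add: bij_betw_finite)
  have "packing_colorable (delete_vertex H y) 3" if "y \<in> verts H" for y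
  proof -
    obtain x where x: "x \<in> verts G" "y = f x"
      using \<open>y \<in> verts H\<close> bij_betw_imp_surj_on[OF f(1)] by blast
    then have "packing_colorable (delete_vertex G x) 3"
      using crit packing_critical_4_iff[OF fin] by blast
    with x show ?thesis
      using packing_colorable_iso[OF graph_iso_sym[OF delete_vertex_iso[OF f x(1)]]] by simp
  qed
  moreover have "packing_colorable H k \<longleftrightarrow> packing_colorable G k" for k
    using packing_colorable_iso[OF iso] packing_colorable_iso[OF graph_iso_sym[OF iso]] by blast
  ultimately show ?thesis
    using crit unfolding packing_critical_4_iff[OF fin] packing_critical_4_iff[OF finH] by simp
qed

section \<open>Three-colourings along paths and cycles\<close>

lemma packing_coloring_walk:
  assumes "packing_coloring G k c" "walk G p" "hd p \<noteq> last p" "c (hd p) = c (last p)"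
  shows "c (hd p) < length p - 1"
proof -
  have "hd p \<in> verts G" "last p \<in> verts G"
    using assms(2) by (auto simp: walk_def)
  with assms show ?thesis
    unfolding packing_coloring_def by (metis gdist_greater_iff)
qed

lemma packing_coloring_adjacent:
  assumes "packing_coloring G k c" "u \<in> verts G" "v \<in> verts G" "{u, v} \<in> edges G" "u \<noteq> v"
  shows "c u \<noteq> c v"
proof
  assume "c u = c v"
  then have "c u < 1" using packing_coloring_walk[OF assms(1), of "[u, v]"] assms
    by (simp add: walk_def)
  then show False using assms(1,2) by (auto simp: packing_coloring_def)
qed

lemma packing_coloring_common_neighbor:
  assumes "packing_coloring G k c" "{u, w, v} \<subseteq> verts G" "{u, w} \<in> edges G" "{w, v} \<in> edges G"
    "u \<noteq> v" "2 \<le> c u"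
  shows "c u \<noteq> c v"
  using packing_coloring_walk[OF assms(1), of "[u, w, v]"] assms by (auto simp: walk_def)

lemma packing_coloring_path3:
  assumes "packing_coloring G k c" "{u, w, x, v} \<subseteq> verts G"
    "{u, w} \<in> edges G" "{w, x} \<in> edges G" "{x, v} \<in> edges G" "u \<noteq> v" "3 \<le> c u"
  shows "c u \<noteq> c v"
  using packing_coloring_walk[OF assms(1), of "[u, w, x, v]"] assms by (auto simp: walk_def)

lemma three_coloring_range:
  assumes "packing_coloring G 3 c" "v \<in> verts G"
  shows "c v = 1 \<or> c v = 2 \<or> c v = 3"
proof -
  have "c v \<in> {1..3}" using assms by (auto simp: packing_coloring_def)
  then show ?thesis by auto
qed

text \<open>Three neighbours of a vertex of colour 1 lie pairwise within distance 2 and would need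
  different colours in \<open>{2, 3}\<close>.\<close>

lemma three_coloring_degree_3:
  assumes c: "packing_coloring G 3 c" and V: "{v, x, y, z} \<subseteq> verts G"
    and E: "{v, x} \<in> edges G" "{v, y} \<in> edges G" "{v, z} \<in> edges G"
    and d: "distinct [v, x, y, z]"
  shows "c v \<noteq> 1"
proof
  assume 1: "c v = 1"
  have *: "c a = 2 \<or> c a = 3" if "a \<in> {x, y, z}" for a
    using three_coloring_range[OF c, of a] packing_coloring_adjacent[OF c, of v a] V E d 1 that
    by auto
  have **: "c a \<noteq> c b" if "a \<in> {x, y, z}" "b \<in> {x, y, z}" "a \<noteq> b" for a b
    using packing_coloring_common_neighbor[OF c, of a v b] *[of a] V E that
    by (auto simp: insert_commute)
  show False using *[of x] *[of y] *[of z] **[of x y] **[of y z] **[of x z] d by auto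
qed

text \<open>In front of adjacent vertices of colours 2 and 3 there is room for only one more vertex:
  it has colour 1, and a vertex before it is too close to each of the three colours.\<close>

lemma three_coloring_no_2_3:
  assumes c: "packing_coloring G 3 c" and V: "{a, b, x, y} \<subseteq> verts G"
    and E: "{a, b} \<in> edges G" "{b, x} \<in> edges G" "{x, y} \<in> edges G"
    and d: "distinct [a, b, x, y]"
  shows "\<not> (c x = 2 \<and> c y = 3)"
proof
  assume xy: "c x = 2 \<and> c y = 3"
  have "c b = 1"
    using three_coloring_range[OF c, of b] packing_coloring_adjacent[OF c, of b x]
      packing_coloring_common_neighbor[OF c, of b x y] V E d xy by auto
  moreover have "c a \<noteq> c b" using packing_coloring_adjacent[OF c, of a b] V E d by auto
  moreover have "c a \<noteq> 2"
    using packing_coloring_common_neighbor[OF c, of a b x] V E d xy by auto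
  moreover have "c a \<noteq> 3"
    using packing_coloring_path3[OF c, of a b x y] V E d xy by auto
  ultimately show False using three_coloring_range[OF c, of a] V by auto
qed

text \<open>Distinctness is required only within windows of four vertices, so that a path in this sense
  may wind around a cycle of length at least 4 arbitrarily often.\<close>

definition winding_path :: "'a ugraph \<Rightarrow> (nat \<Rightarrow> 'a) \<Rightarrow> nat \<Rightarrow> bool" where
  "winding_path G p m \<longleftrightarrow> (\<forall>i\<le>m. p i \<in> verts G) \<and> (\<forall>i<m. {p i, p (i + 1)} \<in> edges G) \<and>
     (\<forall>i. i + 3 \<le> m \<longrightarrow> distinct [p i, p (i + 1), p (i + 2), p (i + 3)])"

text \<open>Of two adjacent vertices at most one has colour 1. If neither has, one of them has colour 2 and
  the other one colour 3, and the path has two more vertices on the side of the former: this is what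
  the bounds on \<open>i\<close> provide on either side.\<close>

lemma three_coloring_alternates:
  assumes c: "packing_coloring G 3 c" and p: "winding_path G p m" and i: "2 \<le> i" "i + 3 \<le> m"
  shows "c (p (i + 1)) = 1 \<longleftrightarrow> c (p i) \<noteq> 1"
proof -
  obtain j where j: "i = j + 2" using i(1) by (metis add.commute le_Suc_ex)
  have V: "p a \<in> verts G" if "a \<le> j + 5" for a
    using p i j that by (auto simp: winding_path_def)
  have E: "{p a, p b} \<in> edges G" if "b = a + 1" "a < j + 5" for a b
    using p i j that by (auto simp: winding_path_def)
  have d: "distinct [p a, p (a + 1), p (a + 2), p (a + 3)]" if "a \<le> j + 2" for a
    using p i j that by (auto simp: winding_path_def)
  have V': "{p j, p (j + 1), p (j + 2), p (j + 3)} \<subseteq> verts G"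
    "{p (j + 5), p (j + 4), p (j + 3), p (j + 2)} \<subseteq> verts G"
    by (simp_all add: V)
  have E': "{p j, p (j + 1)} \<in> edges G" "{p (j + 1), p (j + 2)} \<in> edges G"
    "{p (j + 2), p (j + 3)} \<in> edges G"
    by (rule E; simp)+
  have E'': "{p (j + 5), p (j + 4)} \<in> edges G" "{p (j + 4), p (j + 3)} \<in> edges G"
    "{p (j + 3), p (j + 2)} \<in> edges G"
    by (subst insert_commute, rule E; simp)+
  have d': "distinct [p j, p (j + 1), p (j + 2), p (j + 3)]"
    using d[of j] by simp
  have d'': "distinct [p (j + 5), p (j + 4), p (j + 3), p (j + 2)]"
  proof -
    have "j + 2 + 1 = j + 3" "j + 2 + 2 = j + 4" "j + 2 + 3 = j + 5" by simp_all
    then show ?thesis using d[of "j + 2"] by (simp only:) auto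
  qed
  \<comment> \<open>The path is read forwards in the first case and backwards in the second one.\<close>
  have "\<not> (c (p (j + 2)) = 2 \<and> c (p (j + 3)) = 3)"
    by (rule three_coloring_no_2_3[OF c V'(1) E' d'])
  moreover have "\<not> (c (p (j + 3)) = 2 \<and> c (p (j + 2)) = 3)"
    by (rule three_coloring_no_2_3[OF c V'(2) E'' d''])
  moreover have "c (p (j + 2)) \<noteq> c (p (j + 3))"
    using packing_coloring_adjacent[OF c, of "p (j + 2)" "p (j + 3)"] E' V' d' by simp
  moreover have "p i = p (j + 2)" "p (i + 1) = p (j + 3)"
    using j by (simp_all add: numeral_eq_Suc)
  ultimately show ?thesis
    using three_coloring_range[OF c, of "p (j + 2)"] three_coloring_range[OF c, of "p (j + 3)"] V'
    by auto
qed

lemma three_coloring_parity: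
  assumes c: "packing_coloring G 3 c" and p: "winding_path G p m"
    and "2 \<le> i" "i + d + 2 \<le> m"
  shows "c (p (i + d)) = 1 \<longleftrightarrow> (c (p i) = 1 \<longleftrightarrow> even d)"
  using assms(4)
proof (induction d)
  case (Suc d)
  then show ?case
    using three_coloring_alternates[OF c p, of "i + d"] \<open>2 \<le> i\<close> by auto
qed simp

text \<open>A vertex of degree at least 3 does not have colour 1, while colour 1 alternates along the
  path except near its ends.\<close>

lemma three_coloring_odd_leaves:
  assumes c: "packing_coloring G 3 c" and p: "winding_path G p m"
    and i: "2 \<le> i" "i + d + 2 \<le> m" and "odd d"
    and x: "x \<in> verts G" "{p i, x} \<in> edges G" "x \<notin> range p"
    and y: "y \<in> verts G" "{p (i + d), y} \<in> edges G" "y \<notin> range p"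
  shows False
proof -
  have *: "c (p j) \<noteq> 1"
    if "2 \<le> j" "j + 2 \<le> m" "z \<in> verts G" "{p j, z} \<in> edges G" "z \<notin> range p" for j z
  proof -
    obtain h where h: "j = h + 1" using \<open>2 \<le> j\<close> by (cases j) auto
    have V: "p h \<in> verts G" "p (h + 1) \<in> verts G" "p (h + 2) \<in> verts G"
      and d: "distinct [p h, p (h + 1), p (h + 2)]"
      using p that h by (auto simp: winding_path_def)
    have "{p (h + 1), p (h + 1 + 1)} \<in> edges G" "{p h, p (h + 1)} \<in> edges G"
      using p that h unfolding winding_path_def by auto
    then have E: "{p (h + 1), p (h + 2)} \<in> edges G" "{p (h + 1), p h} \<in> edges G"
      by (simp_all add: insert_commute)
    have "z \<noteq> p k" for k using that by auto
    then have "distinct [p (h + 1), z, p h, p (h + 2)]" using d by simp metis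
    then show ?thesis
      using three_coloring_degree_3[OF c _ _ E(2) E(1), of z] that V h by simp
  qed
  have "c (p i) \<noteq> 1" using *[of i x] i x by auto
  moreover have "c (p (i + d)) \<noteq> 1" using *[of "i + d" y] i y by auto
  ultimately show False using three_coloring_parity[OF c p i] \<open>odd d\<close> by auto
qed

text \<open>Every second vertex has colour 1, and the remaining ones alternate between colours 2 and 3
  because consecutive ones are at distance 2. This pattern has period 4 and no smaller one.\<close>

lemma three_coloring_closed_path:
  assumes c: "packing_coloring G 3 c" and p: "\<And>m. winding_path G p m"
    and per: "\<And>i. p (i + n) = p i"
  shows "4 dvd n"
proof -
  have par: "c (p (i + d)) = 1 \<longleftrightarrow> (c (p i) = 1 \<longleftrightarrow> even d)" if "2 \<le> i" for i d
    using three_coloring_parity[OF c p[of "i + d + 2"] that] by simp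
  obtain i where i: "2 \<le> i" "c (p i) \<noteq> 1"
  proof (cases "c (p 2) = 1")
    case True
    then show ?thesis using par[of 2 1] that[of "2 + 1"] by simp
  qed (use that[of 2] in simp)
  have "even n" using par[OF i(1), of n] i per by auto
  have V: "p j \<in> verts G" for j
    using p[of j] by (simp add: winding_path_def)
  have E: "{p j, p (j + 1)} \<in> edges G" for j
    using p[of "j + 1"] by (simp add: winding_path_def)
  have d: "p j \<noteq> p (j + 2)" for j
    using p[of "j + 3"] by (auto simp: winding_path_def)
  have alt: "c (p (i + 2 * t)) = c (p i) \<longleftrightarrow> even t" for t
  proof (induction t)
    case (Suc t)
    define j where "j = i + 2 * t"
    have j2: "i + 2 * Suc t = j + 2" by (simp add: j_def)
    have 1: "c (p j) \<noteq> 1" "c (p (j + 2)) \<noteq> 1"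
      using par[OF i(1), of "2 * t"] par[OF i(1), of "2 * Suc t"] i(2) unfolding j2
      by (simp_all add: j_def)
    have "{p (j + 1), p (j + 2)} \<in> edges G" using E[of "j + 1"] by (simp add: numeral_eq_Suc)
    then have "c (p j) \<noteq> c (p (j + 2))"
      using packing_coloring_common_neighbor[OF c _ E _ d, of j] V
        three_coloring_range[OF c V, of j] 1 by auto
    then show ?case
      using Suc 1 three_coloring_range[OF c V, of j] three_coloring_range[OF c V, of "j + 2"]
        three_coloring_range[OF c V, of i] i(2)
      unfolding j2 j_def[symmetric] by auto
  qed simp
  obtain t where t: "n = 2 * t" using \<open>even n\<close> by blast
  then have "even t" using alt[of t] per by simp
  with t show ?thesis by auto
qed

section \<open>Leafed cycles\<close>

lemma cycle_graph_edge_iff: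
  "{u, v} \<in> edges (cycle_graph n) \<longleftrightarrow> u < n \<and> v = Suc u mod n \<or> v < n \<and> u = Suc v mod n"
  by (auto simp: cycle_graph_def doubleton_eq_iff)

lemma attach_leaves_edge_iff:
  "{(u, i), (v, j)} \<in> edges (attach_leaves H l) \<longleftrightarrow>
     i = 0 \<and> j = 0 \<and> {u, v} \<in> edges H \<or>
     u = v \<and> u \<in> verts H \<and> (i = 0 \<and> 1 \<le> j \<and> j \<le> l u \<or> j = 0 \<and> 1 \<le> i \<and> i \<le> l u)"
  by (auto simp: attach_leaves_def doubleton_eq_iff insert_commute)

lemma verts_cycle_graph [simp]: "verts (cycle_graph n) = {..<n}"
  by (simp add: cycle_graph_def)

lemma verts_attach_cycle: "(v, j) \<in> verts (attach_leaves (cycle_graph n) l) \<longleftrightarrow> v < n \<and> j \<le> l v"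
  by (simp add: attach_leaves_def cycle_graph_def)

lemma attach_leaves_cong:
  assumes "\<And>v. v \<in> verts H \<Longrightarrow> l v = l' v"
  shows "attach_leaves H l = attach_leaves H l'"
  using assms by (auto simp: attach_leaves_def)

text \<open>The leaves at a vertex are interchangeable. Deleting the one with the largest index yields
  literally a graph of the same form, to which the criteria for leafed cycles apply.\<close>

lemma delete_last_leaf:
  assumes "0 < l v"
  shows "delete_vertex (attach_leaves H l) (v, l v) = attach_leaves H (l(v := l v - 1))"
proof -
  define l' where "l' = l(v := l v - 1)"
  have iff: "j \<le> l' w \<longleftrightarrow> j \<le> l w \<and> (v, l v) \<notin> {(w, 0), (w, j)}" for w j
    using assms by (auto simp: l'_def)
  have base: "(v, l v) \<notin> {(u, 0), (w, 0)}" for u w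
    using assms by simp
  have "{e \<in> edges (attach_leaves H l). (v, l v) \<notin> e} = edges (attach_leaves H l')"
    unfolding attach_leaves_def ugraph.simps using iff base by blast
  moreover have "verts (attach_leaves H l) - {(v, l v)} = verts (attach_leaves H l')"
    using assms by (auto simp: attach_leaves_def l'_def split: if_splits)
  ultimately show ?thesis by (simp add: delete_vertex_def l'_def)
qed

text \<open>Distances are bounded from below by the total displacement around the cycle, where a step
  between a cycle vertex and a leaf counts 0.\<close>

lemma walk_displacement:
  fixes f :: "'a \<Rightarrow> nat"
  assumes step: "\<And>u v. \<lbrakk>u \<in> verts G; v \<in> verts G; {u, v} \<in> edges G\<rbrakk> \<Longrightarrow>
      \<exists>z::int. \<bar>z\<bar> \<le> 1 \<and> int n dvd int (f v) - int (f u) - z"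
    and "walk G p"
  shows "\<exists>z::int. \<bar>z\<bar> \<le> int (length p - 1) \<and> int n dvd int (f (last p)) - int (f (hd p)) - z"
  using assms(2)
proof (induction p)
  case (Cons u p)
  show ?case
  proof (cases p)
    case Nil
    then show ?thesis by (intro exI[of _ 0]) simp
  next
    case (Cons v q)
    with Cons.prems have p: "walk G p" and u: "u \<in> verts G" "v \<in> verts G" "{u, v} \<in> edges G"
      by (auto simp: walk_def)
    obtain z where z: "\<bar>z\<bar> \<le> int (length p - 1)" "int n dvd int (f (last p)) - int (f v) - z"
      using Cons.IH[OF p] Cons by auto
    obtain y where y: "\<bar>y\<bar> \<le> 1" "int n dvd int (f v) - int (f u) - y"
      using step[OF u] by blast
    have "int n dvd (int (f (last p)) - int (f v) - z) + (int (f v) - int (f u) - y)"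
      by (rule dvd_add[OF z(2) y(2)])
    then have "int n dvd int (f (last p)) - int (f u) - (z + y)" by (simp add: algebra_simps)
    moreover have "\<bar>z + y\<bar> \<le> int (length (u # p) - 1)" using z(1) y(1) Cons by auto
    ultimately show ?thesis using Cons by auto
  qed
qed (simp add: walk_def)

lemma displacement_imp_shift:
  assumes "u < n" "v < n" "\<bar>z\<bar> \<le> int i" "int n dvd int v - int u - z"
  shows "\<exists>k\<le>i. v = (u + k) mod n \<or> u = (v + k) mod n"
proof (cases "0 \<le> z")
  case True
  then have "int v mod int n = int (u + nat z) mod int n"
    using assms(4) by (simp add: mod_eq_dvd_iff algebra_simps)
  then have "v = (u + nat z) mod n"
    using assms(2) by (metis mod_less of_nat_eq_iff zmod_int)
  then show ?thesis using assms(3) True by (intro exI[of _ "nat z"]) auto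
next
  case False
  then have "int (v + nat (- z)) mod int n = int u mod int n"
    using assms(4) by (simp add: mod_eq_dvd_iff algebra_simps)
  then have "u = (v + nat (- z)) mod n"
    using assms(1) by (metis mod_less of_nat_eq_iff zmod_int)
  then show ?thesis using assms(3) False by (intro exI[of _ "nat (- z)"]) auto
qed

lemma cycle_edge_displacement:
  assumes "{u, v} \<in> edges (cycle_graph n)"
  shows "\<exists>z::int. \<bar>z\<bar> \<le> 1 \<and> int n dvd int v - int u - z"
proof -
  have *: "int n dvd int (Suc a mod n) - int a - 1" for a
    by (metis add.commute diff_diff_eq mod_eq_dvd_iff mod_mod_trivial of_nat_Suc zmod_int)
  from assms consider "v = Suc u mod n" | "u = Suc v mod n"
    by (auto simp: cycle_graph_edge_iff)
  then show ?thesis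
  proof cases
    case 1
    then show ?thesis using * by (intro exI[of _ 1]) simp
  next
    case 2
    then have "int n dvd - (int (Suc v mod n) - int v - 1)" using * by (simp only: dvd_minus_iff)
    then show ?thesis using 2 by (intro exI[of _ "- 1"]) (simp add: algebra_simps)
  qed
qed

lemma cycle_gdist_greater_iff:
  assumes "u < n" "v < n"
  shows "enat i < gdist (cycle_graph n) u v \<longleftrightarrow>
    (\<forall>k\<le>i. v \<noteq> (u + k) mod n \<and> u \<noteq> (v + k) mod n)"
proof
  assume far: "enat i < gdist (cycle_graph n) u v"
  have walk: "walk (cycle_graph n) (map (\<lambda>j. (a + j) mod n) [0..<Suc k])" for a k
    unfolding walk_def using assms(1)
    by (auto simp: cycle_graph_def successively_conv_nth mod_Suc_eq simp del: upt_Suc)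
  show "\<forall>k\<le>i. v \<noteq> (u + k) mod n \<and> u \<noteq> (v + k) mod n"
  proof (intro allI impI conjI notI)
    fix k assume "k \<le> i" "v = (u + k) mod n"
    then show False
      using far[unfolded gdist_greater_iff, rule_format, OF walk[of u k]] assms
      by (simp add: hd_map last_map del: upt_Suc)
  next
    fix k assume "k \<le> i" "u = (v + k) mod n"
    moreover have "walk (cycle_graph n) (rev (map (\<lambda>j. (v + j) mod n) [0..<Suc k]))"
      using walk[of v k] unfolding walk_def by (simp add: insert_commute del: upt_Suc map_map)
    ultimately show False
      using far[unfolded gdist_greater_iff, rule_format,
          of "rev (map (\<lambda>j. (v + j) mod n) [0..<Suc k])"] assms
      by (simp add: hd_rev last_rev hd_map last_map del: upt_Suc)
  qed
next
  assume *: "\<forall>k\<le>i. v \<noteq> (u + k) mod n \<and> u \<noteq> (v + k) mod n"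
  show "enat i < gdist (cycle_graph n) u v"
    unfolding gdist_greater_iff
  proof (intro allI impI)
    fix p assume p: "walk (cycle_graph n) p" "hd p = u" "last p = v"
    then obtain z where "\<bar>z\<bar> \<le> int (length p - 1)" "int n dvd int v - int u - z"
      using walk_displacement[of "cycle_graph n" n "\<lambda>x. x", OF cycle_edge_displacement p(1)] by auto
    from displacement_imp_shift[OF assms this] * show "i < length p - 1"
      by (metis le_trans not_le)
  qed
qed

text \<open>Only positive displacements have to be considered: of two vertices close to each other, one is
  at a small positive displacement from the other one. A displacement by a full turn is exempt, as it
  arises on short cycles when the colour is at least the length.\<close>

definition cyclic_packing :: "nat \<Rightarrow> (nat \<Rightarrow> nat) \<Rightarrow> bool" where
  "cyclic_packing n d \<longleftrightarrow>
     (\<forall>i<n. \<forall>k\<in>{1..d i}. (i + k) mod n \<noteq> i \<longrightarrow> d ((i + k) mod n) \<noteq> d i)"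

text \<open>Leaves can always take colour 1, unless their neighbour on the cycle does.\<close>

lemma leafed_cycle_coloring:
  assumes d: "cyclic_packing n d" and K: "\<And>i. i < n \<Longrightarrow> d i \<in> {1..K}"
    and l: "\<And>i. \<lbrakk>i < n; 0 < l i\<rbrakk> \<Longrightarrow> d i \<noteq> 1"
  shows "packing_coloring (attach_leaves (cycle_graph n) l) K (\<lambda>(v, j). if j = 0 then d v else 1)"
    (is "packing_coloring ?H K ?c")
  unfolding packing_coloring_def gdist_greater_iff
proof (intro conjI ballI impI allI)
  fix x assume "x \<in> verts ?H"
  then show "?c x \<in> {1..K}"
    using K[of "fst x"] by (cases x) (auto simp: verts_attach_cycle)
next
  fix x y p
  assume xy: "x \<in> verts ?H" "y \<in> verts ?H" "x \<noteq> y" "?c x = ?c y"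
    and p: "walk ?H p" "hd p = x" "last p = y"
  show "?c x < length p - 1"
  proof (rule ccontr)
    assume short: "\<not> ?c x < length p - 1"
    obtain u i where x: "x = (u, i)" by (cases x)
    obtain v j where y: "y = (v, j)" by (cases y)
    have uv: "u < n" "v < n" "i \<le> l u" "j \<le> l v" using xy x y by (auto simp: verts_attach_cycle)
    show False
    proof (cases "i = 0 \<and> j = 0")
      case True
      have step: "\<exists>z::int. \<bar>z\<bar> \<le> 1 \<and> int n dvd int (fst b) - int (fst a) - z"
        if "{a, b} \<in> edges ?H" for a b
        using that cycle_edge_displacement[of "fst a" "fst b" n]
        by (cases a; cases b) (auto simp: attach_leaves_edge_iff intro: exI[of _ 0])
      obtain z where "\<bar>z\<bar> \<le> int (length p - 1)" "int n dvd int v - int u - z"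
        using walk_displacement[of ?H n fst, OF step p(1)] p x y by auto
      from displacement_imp_shift[OF uv(1,2) this]
      obtain k where "k \<le> length p - 1" and shift: "v = (u + k) mod n \<or> u = (v + k) mod n"
        by blast
      then have k: "k \<le> d u" "v = (u + k) mod n \<or> u = (v + k) mod n"
        using short True x by simp_all
      moreover have "u \<noteq> v" "d u = d v" using xy x y True by auto
      moreover have "k \<noteq> 0"
      proof
        assume "k = 0"
        then show False using k(2) \<open>u \<noteq> v\<close> uv by simp
      qed
      ultimately show False
        using d uv(1,2) unfolding cyclic_packing_def by (metis atLeastAtMost_iff less_one not_less)
    next
      case False
      then have 1: "?c x = 1" "?c y = 1" using xy x y by (auto split: if_splits)
      then have "length p \<le> 2" using short by auto
      moreover have "p \<noteq> []" using p by (auto simp: walk_def)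
      moreover have "tl p \<noteq> []" using p xy \<open>p \<noteq> []\<close> by (cases p) auto
      ultimately have "p = [x, y]" using p
        by (cases p; cases "tl p") (auto split: if_splits)
      then have "{x, y} \<in> edges ?H" using p by (simp add: walk_def)
      then show False using 1 l[of u] l[of v] uv False x y
        by (auto simp: attach_leaves_edge_iff)
    qed
  qed
qed

lemma mod_add_neq:
  fixes n :: nat
  assumes "j < k" "k < j + n"
  shows "(a + j) mod n \<noteq> (a + k) mod n"
proof
  assume "(a + j) mod n = (a + k) mod n"
  then have "n dvd (a + k) - (a + j)"
    using assms by (metis add_le_cancel_left less_imp_le mod_eq_dvd_iff_nat)
  then show False using assms by (auto dest: dvd_imp_le)
qed

lemma winding_path_leafed_cycle:
  assumes "4 \<le> n"
  shows "winding_path (attach_leaves (cycle_graph n) l) (\<lambda>i. ((s + i) mod n, 0)) m"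
proof -
  have "(s + (i + 1)) mod n = Suc ((s + i) mod n) mod n" for i by (simp add: mod_Suc_eq)
  moreover have "distinct (map (\<lambda>j. (s + j) mod n) [i, i + 1, i + 2, i + 3])" for i
    using mod_add_neq[of i "i + 1" n s] mod_add_neq[of i "i + 2" n s]
      mod_add_neq[of i "i + 3" n s] mod_add_neq[of "i + 1" "i + 2" n s]
      mod_add_neq[of "i + 1" "i + 3" n s] mod_add_neq[of "i + 2" "i + 3" n s] assms
    by simp
  ultimately show ?thesis
    unfolding winding_path_def using assms
    by (simp add: verts_attach_cycle attach_leaves_edge_iff cycle_graph_edge_iff)
qed

lemma winding_path_delete_vertex:
  assumes "winding_path G p m" "\<And>i. i \<le> m \<Longrightarrow> p i \<noteq> x"
  shows "winding_path (delete_vertex G x) p m"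
  using assms(1) by (simp add: winding_path_def delete_vertex_def assms(2) assms(2)[symmetric])

definition alternating_color :: "nat \<Rightarrow> nat \<Rightarrow> nat" where
  "alternating_color r i = (if i mod 2 = r then 1 else if i mod 4 < 2 then 2 else 3)"

lemma alternating_color_range: "alternating_color r i \<in> {1..3}"
  by (simp add: alternating_color_def)

lemma alternating_color_shift:
  assumes "r < 2" "1 \<le> k" "k \<le> alternating_color r i"
  shows "alternating_color r (i + k) \<noteq> alternating_color r i"
proof -
  define a where "a = i mod 4"
  have mod4: "(i + k) mod 4 = (a + k) mod 4" by (simp add: a_def mod_add_left_eq)
  have mod2: "i mod 2 = a mod 2" by (simp add: a_def mod_mod_cancel)
  then have mod2': "(i + k) mod 2 = (a + k) mod 2" by (metis mod_add_left_eq)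
  have "a < 4" by (simp add: a_def)
  then have "a = 0 \<or> a = 1 \<or> a = 2 \<or> a = 3" "r = 0 \<or> r = 1"
    using assms(1) by linarith+
  moreover have "k = 1 \<or> k = 2 \<or> k = 3"
    using assms(2,3) alternating_color_range[of r i] by auto
  ultimately show ?thesis
    using assms(3) unfolding alternating_color_def mod2 mod2' mod4 a_def[symmetric]
    by (elim disjE) simp_all
qed

lemma cyclic_packing_alternating:
  assumes "4 dvd n" "r < 2"
  shows "cyclic_packing n (alternating_color r)"
proof -
  have "2 dvd n" using assms(1) by (rule dvd_trans[rotated]) simp
  then have "alternating_color r (i mod n) = alternating_color r i" for i
    using assms(1) unfolding alternating_color_def by (simp only: mod_mod_cancel)
  then show ?thesis
    using alternating_color_shift[OF assms(2)] by (simp add: cyclic_packing_def)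
qed

text \<open>Leafed vertices cannot have colour 1, which occupies a full parity class. The colouring that
  puts colour 1 on the class without leaves alternates between 2 and 3 on the other class.\<close>

theorem leafed_cycle_3_colorable_iff:
  assumes n: "4 \<le> n"
  shows "packing_colorable (attach_leaves (cycle_graph n) l) 3 \<longleftrightarrow>
    4 dvd n \<and> (\<exists>r<2. \<forall>v<n. v mod 2 = r \<longrightarrow> l v = 0)" (is "packing_colorable ?H 3 \<longleftrightarrow> ?R")
proof
  assume "packing_colorable ?H 3"
  then obtain c where c: "packing_coloring ?H 3 c" unfolding packing_colorable_def by blast
  define p where "p i = (i mod n, 0::nat)" for i
  have p: "winding_path ?H p m" for m
    using winding_path_leafed_cycle[OF n, of l 0 m] by (simp add: p_def[abs_def])
  have "4 dvd n" by (rule three_coloring_closed_path[OF c p]) (simp add: p_def)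
  moreover have "\<exists>r<2. \<forall>v<n. v mod 2 = r \<longrightarrow> l v = 0"
  proof (rule ccontr)
    assume no: "\<not> ?thesis"
    obtain u where u: "u < n" "even u" "0 < l u" using no by (auto dest!: spec[of _ 0])
    obtain v where v: "v < n" "odd v" "0 < l v"
      using no by (auto dest!: spec[of _ 1] simp: odd_iff_mod_2_eq_one)
    \<comment> \<open>One full turn before \<open>u\<close> and another one before \<open>v\<close> keep the positions at least 2 and
      ordered.\<close>
    define e where "e = v + n - u"
    have e: "u + n + e = v + n + n" "odd e"
      using u v \<open>4 dvd n\<close> by (auto simp: e_def)
    have "(u + n + e) mod n = v" unfolding e(1) using v by simp
    then have p_e: "p (u + n + e) = (v, 0)" "p (u + n) = (u, 0)" using u by (simp_all add: p_def)
    have leaf: "(w, 1) \<in> verts ?H" "{(w, 0), (w, 1)} \<in> edges ?H" "(w, 1) \<notin> range p"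
      if "w < n" "0 < l w" for w
      using that by (auto simp: verts_attach_cycle attach_leaves_edge_iff p_def)
    show False
      by (rule three_coloring_odd_leaves[OF c p[of "u + n + e + 2"], of "u + n" e "(u, 1)" "(v, 1)"])
        (use leaf[OF u(1,3)] leaf[OF v(1,3)] e(2) p_e n in simp_all)
  qed
  ultimately show ?R ..
next
  assume ?R
  then obtain r where r: "4 dvd n" "r < 2" "\<And>v. \<lbrakk>v < n; v mod 2 = r\<rbrakk> \<Longrightarrow> l v = 0" by blast
  have "packing_coloring ?H 3 (\<lambda>(v, j). if j = 0 then alternating_color r v else 1)"
    by (rule leafed_cycle_coloring[OF cyclic_packing_alternating[OF r(1,2)]])
      (use r alternating_color_range in \<open>auto simp: alternating_color_def split: if_splits\<close>)
  then show "packing_colorable ?H 3" unfolding packing_colorable_def by blast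
qed

lemma cyclic_packing_inj:
  assumes "inj_on d {..<n}"
  shows "cyclic_packing n d"
  unfolding cyclic_packing_def
proof (intro allI impI ballI notI)
  fix i k assume "i < n" "(i + k) mod n \<noteq> i" "d ((i + k) mod n) = d i"
  then show False using inj_onD[OF assms, of "(i + k) mod n" i] by simp
qed

lemma less_3_cases: "v < 3 \<longleftrightarrow> v = 0 \<or> v = 1 \<or> v = 2" for v :: nat
  by auto

text \<open>The three vertices of the triangle have different colours, so that one of them has colour 1 and
  thus carries no leaf.\<close>

theorem leafed_triangle_3_colorable_iff:
  "packing_colorable (attach_leaves (cycle_graph 3) l) 3 \<longleftrightarrow> (\<exists>v<3. l v = 0)"
  (is "packing_colorable ?H 3 \<longleftrightarrow> ?R")
proof
  assume "packing_colorable ?H 3"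
  then obtain c where c: "packing_coloring ?H 3 c" unfolding packing_colorable_def by blast
  show ?R
  proof (rule ccontr)
    assume "\<not> ?R"
    then have l: "0 < l v" if "v < 3" for v using that by auto
    have "c (v, 0) \<noteq> 1" if "v < 3" for v
    proof -
      show ?thesis
        by (rule three_coloring_degree_3[OF c, of _ "(v, 1)" "(Suc v mod 3, 0)" "(Suc (Suc v) mod 3, 0)"];
          insert l[OF that] that[unfolded less_3_cases]; elim disjE;
          simp add: verts_attach_cycle attach_leaves_edge_iff cycle_graph_edge_iff)
    qed
    then have "c (0, 0) \<noteq> 1" "c (1, 0) \<noteq> 1" "c (2, 0) \<noteq> 1" by simp_all
    moreover have "c (0, 0) \<noteq> c (1, 0)" "c (1, 0) \<noteq> c (2, 0)" "c (0, 0) \<noteq> c (2, 0)"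
      by (rule packing_coloring_adjacent[OF c];
          simp add: verts_attach_cycle attach_leaves_edge_iff cycle_graph_edge_iff)+
    ultimately show False
      using three_coloring_range[OF c, of "(0, 0)"] three_coloring_range[OF c, of "(1, 0)"]
        three_coloring_range[OF c, of "(2, 0)"]
      by (auto simp: verts_attach_cycle)
  qed
next
  assume ?R
  then obtain v where v: "v < 3" "l v = 0" by blast
  define d where "d = (\<lambda>_. 3::nat)(v := 1, Suc v mod 3 := 2)"
  have inj: "inj_on d {..<3}" using v(1) unfolding less_3_cases inj_on_def d_def
    by (elim disjE) (auto simp: less_3_cases)
  have "packing_coloring ?H 3 (\<lambda>(v, j). if j = 0 then d v else 1)"
    by (rule leafed_cycle_coloring[OF cyclic_packing_inj[OF inj]])
      (use v in \<open>auto simp: d_def split: if_splits\<close>)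
  then show "packing_colorable ?H 3" unfolding packing_colorable_def by blast
qed

text \<open>After deleting a vertex outside an odd arc between two leafed vertices, the path that remains
  still contains two vertices beyond each end of this arc.\<close>

lemma delete_far_cycle_vertex_not_3_colorable:
  assumes n: "4 \<le> n" and a: "a < n" "0 < l a" and b: "0 < l ((a + d) mod n)"
    and d: "odd d" "d + 6 \<le> n"
  shows "\<not> packing_colorable
    (delete_vertex (attach_leaves (cycle_graph n) l) ((a + n - 3) mod n, 0)) 3"
proof
  let ?H = "attach_leaves (cycle_graph n) l"
  \<comment> \<open>The path starts just after the deleted vertex, two vertices before \<open>a\<close>, and ends two
    vertices after the other end of the arc.\<close>
  let ?w = "((a + n - 3) mod n, 0::nat)"
  let ?p = "\<lambda>i. ((a + n - 2 + i) mod n, 0::nat)"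
  assume "packing_colorable (delete_vertex ?H ?w) 3"
  then obtain c where c: "packing_coloring (delete_vertex ?H ?w) 3 c"
    unfolding packing_colorable_def by blast
  have p: "winding_path (delete_vertex ?H ?w) ?p (d + 4)"
  proof (rule winding_path_delete_vertex[OF winding_path_leafed_cycle[OF n]])
    fix i assume "i \<le> d + 4"
    then have "(a + n - 3 + 0) mod n \<noteq> (a + n - 3 + (i + 1)) mod n"
      using d by (intro mod_add_neq) auto
    moreover have "a + n - 3 + (i + 1) = a + n - 2 + i" using n by simp
    ultimately show "?p i \<noteq> ?w" by (metis add_0_right prod.inject)
  qed
  have leaf: "(w, 1) \<in> verts (delete_vertex ?H ?w)"
    "{(w, 0), (w, 1)} \<in> edges (delete_vertex ?H ?w)" "(w, 1) \<notin> range ?p"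
    if "w < n" "0 < l w" "(w, 0) \<noteq> ?w" for w
    using that by (auto simp: delete_vertex_def verts_attach_cycle attach_leaves_edge_iff)
  have w: "?p i \<noteq> ?w" if "i \<le> d + 4" for i
    using p that unfolding winding_path_def delete_vertex_def by auto
  have "a + n - 2 + 2 = a + n" "a + n - 2 + (2 + d) = a + d + n" using n by auto
  then have pa: "?p 2 = (a, 0)" "?p (2 + d) = ((a + d) mod n, 0)"
    using a by (simp_all only: mod_add_self2 mod_less)
  have la: "(a, 0) \<noteq> ?w" "((a + d) mod n, 0) \<noteq> ?w"
    using w[of 2] w[of "2 + d"] unfolding pa by auto
  show False
    by (rule three_coloring_odd_leaves[OF c p, of 2 d "(a, 1)" "((a + d) mod n, 1)"])
      (use leaf[OF a la(1)] leaf[OF _ b la(2)] pa d n in simp_all)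
qed

section \<open>The critical graphs\<close>

lemma packing_coloring_delete_vertex:
  assumes c: "packing_coloring G 4 c" and 4: "\<And>v. v \<in> verts G \<Longrightarrow> c v = 4 \<longleftrightarrow> v = x"
  shows "packing_colorable (delete_vertex G x) 3"
proof -
  have walk: "walk G p" if "walk (delete_vertex G x) p" for p
    using that by (auto simp: walk_def delete_vertex_def elim!: successively_mono)
  have V: "v \<in> verts G" "c v \<noteq> 4" if "v \<in> verts (delete_vertex G x)" for v
    using that 4 by (auto simp: delete_vertex_def)
  have "c v \<in> {1..3}" if "v \<in> verts (delete_vertex G x)" for v
    using V[OF that] c unfolding packing_coloring_def by force
  moreover have "enat (c u) < gdist (delete_vertex G x) u v"
    if "u \<in> verts (delete_vertex G x)" "v \<in> verts (delete_vertex G x)" "u \<noteq> v" "c u = c v" for u v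
    using c that V walk unfolding packing_coloring_def gdist_greater_iff by blast
  ultimately have "packing_coloring (delete_vertex G x) 3 c"
    unfolding packing_coloring_def by blast
  then show ?thesis unfolding packing_colorable_def by blast
qed

lemma finite_verts_leafed_cycle: "finite (verts (attach_leaves (cycle_graph n) l))"
proof (rule finite_subset)
  show "verts (attach_leaves (cycle_graph n) l) \<subseteq> (SIGMA v:{..<n}. {..l v})"
    by (auto simp: verts_attach_cycle)
qed simp

text \<open>A 4-colouring with a single vertex \<open>w\<close> of colour 4 shows both that the graph is 4-colourable
  and that deleting \<open>w\<close> makes it 3-colourable.\<close>

lemma leafed_cycle_criticalI:
  assumes "0 < n"
    and not3: "\<not> packing_colorable (attach_leaves (cycle_graph n) l) 3"
    and cycle: "\<And>w. w < n \<Longrightarrow> \<exists>d. cyclic_packing n d \<and>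
      (\<forall>i<n. d i \<in> {1..4} \<and> (d i = 4 \<longleftrightarrow> i = w) \<and> (0 < l i \<longrightarrow> d i \<noteq> 1))"
    and leaf: "\<And>w. \<lbrakk>w < n; 0 < l w\<rbrakk> \<Longrightarrow>
      l w = 1 \<and> packing_colorable (attach_leaves (cycle_graph n) (l(w := 0))) 3"
  shows "packing_critical 4 (attach_leaves (cycle_graph n) l)"
proof -
  let ?H = "attach_leaves (cycle_graph n) l"
  have col: "\<exists>c. packing_coloring ?H 4 c \<and> (\<forall>v\<in>verts ?H. c v = 4 \<longleftrightarrow> v = (w, 0))"
    if w: "w < n" for w
  proof -
    obtain d where d: "cyclic_packing n d"
      and d': "\<And>i. i < n \<Longrightarrow> d i \<in> {1..4} \<and> (d i = 4 \<longleftrightarrow> i = w) \<and> (0 < l i \<longrightarrow> d i \<noteq> 1)"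
      using cycle[OF w] by blast
    have "packing_coloring ?H 4 (\<lambda>(v, j). if j = 0 then d v else 1)"
      by (rule leafed_cycle_coloring[OF d]) (use d' in auto)
    then show ?thesis
      using d' by (intro exI conjI) (auto simp: verts_attach_cycle split: if_splits)
  qed
  have "packing_colorable ?H 4"
    using col[OF \<open>0 < n\<close>] unfolding packing_colorable_def by blast
  moreover have "packing_colorable (delete_vertex ?H x) 3" if "x \<in> verts ?H" for x
  proof -
    obtain w j where x: "x = (w, j)" "w < n" "j \<le> l w"
      using \<open>x \<in> verts ?H\<close> by (cases x) (auto simp: verts_attach_cycle)
    show ?thesis
    proof (cases "j = 0")
      case True
      then show ?thesis using col[OF x(2)] x packing_coloring_delete_vertex by metis
    next
      case False
      then have "x = (w, l w)" "0 < l w" "l w = 1" using x leaf[of w] by auto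
      then show ?thesis using leaf[of w] x delete_last_leaf[of l w "cycle_graph n"] by simp
    qed
  qed
  ultimately show ?thesis
    using not3 by (simp add: packing_critical_4_iff finite_verts_leafed_cycle)
qed

lemma cyclic_packing_rotate:
  assumes d: "cyclic_packing n d" and "0 < n"
  shows "cyclic_packing n (\<lambda>i. d ((i + s) mod n))"
  unfolding cyclic_packing_def
proof (intro allI impI ballI)
  fix i k assume i: "i < n" and k: "k \<in> {1..d ((i + s) mod n)}" and neq: "(i + k) mod n \<noteq> i"
  have eq: "((i + k) mod n + s) mod n = ((i + s) mod n + k) mod n"
    by (simp add: mod_simps ac_simps)
  have "((i + s) mod n + k) mod n \<noteq> (i + s) mod n"
  proof
    assume "((i + s) mod n + k) mod n = (i + s) mod n"
    then have "int n dvd int ((i + s) mod n + k) - int ((i + s) mod n)"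
      by (metis mod_eq_dvd_iff mod_mod_trivial zmod_int)
    then have "n dvd k" by simp
    then show False using neq i by (metis dvd_imp_mod_0 mod_add_right_eq mod_less add_0_right)
  qed
  then show "d (((i + k) mod n + s) mod n) \<noteq> d ((i + s) mod n)"
    using d k \<open>0 < n\<close> unfolding eq cyclic_packing_def by simp
qed

lemma cyclic_packing_fresh:
  assumes "cyclic_packing n d" "\<And>i. i < n \<Longrightarrow> d i \<noteq> q"
  shows "cyclic_packing n (d(w := q))"
  unfolding cyclic_packing_def
proof (intro allI impI ballI)
  fix i k assume *: "i < n" "k \<in> {1..(d(w := q)) i}" "(i + k) mod n \<noteq> i"
  then have "(i + k) mod n < n" by simp
  then show "(d(w := q)) ((i + k) mod n) \<noteq> (d(w := q)) i"
    using * assms unfolding cyclic_packing_def by (metis fun_upd_apply)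
qed

text \<open>The pattern 1, 2, 1, 3 is interrupted by a single 4, whatever the length of the cycle. After the
  cut it starts with 1, 2, which lie far enough from the last 3, 1 or 2 before the cut.\<close>

lemma cyclic_packing_cut_alternating:
  assumes n: "3 \<le> n"
  shows "cyclic_packing n ((alternating_color 0)(n - 1 := 4))" (is "cyclic_packing n ?d")
  unfolding cyclic_packing_def
proof (intro allI impI ballI)
  fix i k assume i: "i < n" and k: "k \<in> {1..?d i}" and neq: "(i + k) mod n \<noteq> i"
  have not4: "alternating_color 0 j \<noteq> 4" for j
    using alternating_color_range[of 0 j] by auto
  show "?d ((i + k) mod n) \<noteq> ?d i"
  proof (cases "i = n - 1")
    case True
    then show ?thesis using neq not4[of "(i + k) mod n"] by simp
  next
    case False
    then have i': "i + 2 \<le> n" using i by simp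
    have k': "1 \<le> k" "k \<le> alternating_color 0 i" using k False by auto
    then have "k \<le> 3" using alternating_color_range[of 0 i] by auto
    show ?thesis
    proof (cases "i + k < n")
      case True
      then show ?thesis
        using False not4[of i] alternating_color_shift[OF _ k'] by auto
    next
      case wrap: False
      then have mod: "(i + k) mod n = i + k - n"
        using i \<open>k \<le> 3\<close> n by (simp add: le_mod_geq)
      consider "i + k - n = 0" "alternating_color 0 i \<noteq> 1"
        | "i + k - n = 1" "alternating_color 0 i \<noteq> 2"
        using wrap i' k' \<open>k \<le> 3\<close> by linarith
      then show ?thesis
      proof cases
        case 1
        then show ?thesis using n False by (simp add: mod alternating_color_def[of 0 0])
      next
        case 2
        moreover have "alternating_color 0 1 = 2" by (simp add: alternating_color_def)
        ultimately show ?thesis using n False not4[of i] by (simp add: mod)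
      qed
    qed
  qed
qed

text \<open>By rotation, the vertex of colour 4 can be any vertex.\<close>

theorem cycle_critical:
  assumes n: "5 \<le> n" "n mod 4 \<noteq> 0"
  shows "packing_critical 4 (attach_leaves (cycle_graph n) (\<lambda>_. 0))"
proof (rule leafed_cycle_criticalI)
  show "\<not> packing_colorable (attach_leaves (cycle_graph n) (\<lambda>_. 0)) 3"
    using n by (subst leafed_cycle_3_colorable_iff) auto
next
  fix w assume w: "w < n"
  let ?d = "(alternating_color 0)(n - 1 := 4)"
  have d: "?d i \<in> {1..4}" "?d i = 4 \<longleftrightarrow> i = n - 1" for i
    using alternating_color_range[of 0 i] by auto
  have "(i + (n - 1 - w)) mod n = n - 1 \<longleftrightarrow> i = w" if "i < n" for i
    using that w by (auto simp: mod_if split: if_splits)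
  then show "\<exists>d. cyclic_packing n d \<and>
      (\<forall>i<n. d i \<in> {1..4} \<and> (d i = 4 \<longleftrightarrow> i = w) \<and> (0 < (0::nat) \<longrightarrow> d i \<noteq> 1))"
    using cyclic_packing_rotate[OF cyclic_packing_cut_alternating, of n "n - 1 - w"] n d
    by (intro exI[of _ "\<lambda>i. ?d ((i + (n - 1 - w)) mod n)"]) (simp del: fun_upd_apply)
qed (use n in auto)

theorem leafed_triangle_critical:
  "packing_critical 4 (attach_leaves (cycle_graph 3) (\<lambda>_. 1))"
proof (rule leafed_cycle_criticalI)
  show "\<not> packing_colorable (attach_leaves (cycle_graph 3) (\<lambda>_. 1)) 3"
    by (simp add: leafed_triangle_3_colorable_iff)
next
  fix w :: nat assume w: "w < 3"
  let ?d = "(\<lambda>_. 3::nat)(w := 4, Suc w mod 3 := 2)"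
  have "inj_on ?d {..<3}" using w unfolding less_3_cases inj_on_def
    by (elim disjE) (auto simp: less_3_cases)
  then show "\<exists>d. cyclic_packing 3 d \<and>
      (\<forall>i<3. d i \<in> {1..4} \<and> (d i = 4 \<longleftrightarrow> i = w) \<and> (0 < (1::nat) \<longrightarrow> d i \<noteq> 1))"
    using w by (intro exI[of _ ?d] conjI cyclic_packing_inj) (auto simp: mod_if)
qed (auto simp: leafed_triangle_3_colorable_iff)

text \<open>Removing \<open>u\<close>, \<open>v\<close> or one of their leaves frees a whole parity class for colour 1. Only the
  other vertices of the cycle require individual colourings.\<close>

lemma two_leafed_cycle_critical:
  assumes n: "4 dvd n" "0 < n" and uv: "u < n" "v < n" "u mod 2 \<noteq> v mod 2"
    and other: "\<And>w. \<lbrakk>w < n; w \<noteq> u; w \<noteq> v\<rbrakk> \<Longrightarrow> \<exists>d. cyclic_packing n d \<and>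
      (\<forall>i<n. d i \<in> {1..4} \<and> (d i = 4 \<longleftrightarrow> i = w)) \<and> d u \<noteq> 1 \<and> d v \<noteq> 1"
  shows "packing_critical 4 (attach_leaves (cycle_graph n) (\<lambda>w. if w \<in> {u, v} then 1 else 0))"
    (is "packing_critical 4 (attach_leaves _ ?l)")
proof (rule leafed_cycle_criticalI)
  have n4: "4 \<le> n" using n by (auto dest: dvd_imp_le)
  have mod2: "w mod 2 < 2" for w :: nat by simp
  show "\<not> packing_colorable (attach_leaves (cycle_graph n) ?l) 3"
    unfolding leafed_cycle_3_colorable_iff[OF n4]
  proof (intro notI, elim conjE exE)
    fix r :: nat assume "r < 2" and r: "\<forall>w<n. w mod 2 = r \<longrightarrow> ?l w = 0"
    then have "r = u mod 2 \<or> r = v mod 2" using uv(3) mod2[of u] mod2[of v] by linarith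
    then show False using r[rule_format, OF uv(1)] r[rule_format, OF uv(2)] by auto
  qed
  show "?l w = 1 \<and> packing_colorable (attach_leaves (cycle_graph n) (?l(w := 0))) 3"
    if "w < n" "0 < ?l w" for w
  proof
    show "?l w = 1" using that by (simp split: if_splits)
    have "(?l(w := 0)) x = 0" if "x mod 2 = w mod 2" for x
      using \<open>0 < ?l w\<close> that uv(3) by (auto split: if_splits)
    then show "packing_colorable (attach_leaves (cycle_graph n) (?l(w := 0))) 3"
      unfolding leafed_cycle_3_colorable_iff[OF n4] using n(1) mod2[of w] by blast
  qed
  show "\<exists>d. cyclic_packing n d \<and>
      (\<forall>i<n. d i \<in> {1..4} \<and> (d i = 4 \<longleftrightarrow> i = w) \<and> (0 < ?l i \<longrightarrow> d i \<noteq> 1))" if w: "w < n" for w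
  proof (cases "w = u \<or> w = v")
    case True
    \<comment> \<open>The only leafed vertex in the parity class of \<open>w\<close> is \<open>w\<close> itself.\<close>
    let ?d = "(alternating_color (w mod 2))(w := 4)"
    have not4: "alternating_color r i \<noteq> 4" for r i
      using alternating_color_range[of r i] by auto
    have "cyclic_packing n ?d"
      by (intro cyclic_packing_fresh cyclic_packing_alternating n mod2 not4)
    moreover have "?d i \<in> {1..4}" "?d i = 4 \<longleftrightarrow> i = w" for i
      using alternating_color_range[of "w mod 2" i] by auto
    moreover have "?d i \<noteq> 1" if "0 < ?l i" for i
      using that True uv(3) by (auto simp: alternating_color_def split: if_splits)
    ultimately show ?thesis by blast
  next
    case False
    then obtain d where "cyclic_packing n d" "d u \<noteq> 1" "d v \<noteq> 1"
      "\<forall>i<n. d i \<in> {1..4} \<and> (d i = 4 \<longleftrightarrow> i = w)"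
      using other[of w] w by blast
    then show ?thesis by (intro exI[of _ d]) (auto split: if_splits)
  qed
qed (use n in simp)

theorem leafed_C4_critical:
  assumes "{u, v} \<in> edges (cycle_graph 4)"
  shows "packing_critical 4 (attach_leaves (cycle_graph 4) (\<lambda>w. if w \<in> {u, v} then 1 else 0))"
proof (rule two_leafed_cycle_critical)
  have cases: "x < 4 \<longleftrightarrow> x = 0 \<or> x = 1 \<or> x = 2 \<or> x = 3" for x :: nat by auto
  show uv: "u < 4" "v < 4" using assms by (auto simp: cycle_graph_edge_iff)
  show parity: "u mod 2 \<noteq> v mod 2"
    using assms unfolding cycle_graph_edge_iff cases by (elim disjE conjE) simp_all
  fix w assume w: "w < 4" "w \<noteq> u" "w \<noteq> v"
  \<comment> \<open>Only one vertex is left for colour 1.\<close>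
  let ?d = "(\<lambda>_. 1::nat)(u := 2, v := 3, w := 4)"
  have "u \<noteq> v" using parity by auto
  have "inj_on ?d {..<4}"
  proof (rule inj_onI, rule ccontr)
    fix i j assume ij: "i \<in> {..<4}" "j \<in> {..<4}" "?d i = ?d j" "i \<noteq> j"
    then have "i \<notin> {u, v, w}" "j \<notin> {u, v, w}"
      by (auto split: if_splits)
    then have "card {i, j, u, v, w} = 5" using ij w \<open>u \<noteq> v\<close> by auto
    moreover have "card {i, j, u, v, w} \<le> card {..<4::nat}"
      by (rule card_mono) (use ij uv w in auto)
    ultimately show False by simp
  qed
  then show "\<exists>d. cyclic_packing 4 d \<and> (\<forall>i<4. d i \<in> {1..4} \<and> (d i = 4 \<longleftrightarrow> i = w)) \<and> d u \<noteq> 1 \<and> d v \<noteq> 1"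
    using w \<open>u \<noteq> v\<close> by (intro exI[of _ ?d] conjI cyclic_packing_inj) auto
qed auto

text \<open>The leafed vertices are 0 and 3. Reversing a colouring for \<open>t\<close> and shifting it by 3 gives one
  for \<open>(3 - t) mod 8\<close>, so that there are three essentially different cases. In each of them colour 1 ceases to alternate
  once, at adjacent vertices of colours 2 and 3 near an end of the path that remains without \<open>t\<close>;
  this makes it possible that 0 and 3 both avoid colour 1.\<close>

lemma C8_colorings:
  assumes "t < 8" "t \<noteq> 0" "t \<noteq> 3"
  shows "\<exists>d. cyclic_packing 8 d \<and> (\<forall>i<8. d i \<in> {1..4} \<and> (d i = 4 \<longleftrightarrow> i = t)) \<and>
    d 0 \<noteq> 1 \<and> d 3 \<noteq> 1" (is "?P t")
proof -
  have all: "(\<forall>i<8. Q i) \<longleftrightarrow> Q 0 \<and> Q 1 \<and> Q 2 \<and> Q 3 \<and> Q 4 \<and> Q 5 \<and> Q 6 \<and> Q (7::nat)" for Q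
    by (simp add: numeral_eq_Suc All_less_Suc conj_ac)
  have ball: "(\<forall>k\<in>{1..1}. Q k) \<longleftrightarrow> Q 1" "(\<forall>k\<in>{1..2}. Q k) \<longleftrightarrow> Q 1 \<and> Q 2"
    "(\<forall>k\<in>{1..3}. Q k) \<longleftrightarrow> Q 1 \<and> Q 2 \<and> Q 3" "(\<forall>k\<in>{1..4}. Q k) \<longleftrightarrow> Q 1 \<and> Q 2 \<and> Q 3 \<and> Q (4::nat)" for Q
    by (auto simp: numeral_eq_Suc atLeastAtMostSuc_conv)
  note simps = cyclic_packing_def all ball[simplified]
  have "?P 1" by (rule exI[of _ "nth [3, 4, 1, 2, 3, 1, 2, 1]"]) (simp add: simps)
  moreover have "?P 2" by (rule exI[of _ "nth [2, 1, 4, 3, 1, 2, 1, 3]"]) (simp add: simps)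
  moreover have "?P 4" by (rule exI[of _ "nth [2, 1, 3, 2, 4, 1, 3, 1]"]) (simp add: simps)
  moreover have "?P 7" by (rule exI[of _ "nth [2, 3, 1, 2, 1, 3, 1, 4]"]) (simp add: simps)
  moreover have "?P 5" by (rule exI[of _ "nth [2, 1, 3, 2, 1, 4, 3, 1]"]) (simp add: simps)
  moreover have "?P 6" by (rule exI[of _ "nth [2, 3, 1, 2, 1, 3, 4, 1]"]) (simp add: simps)
  moreover have "t = 1 \<or> t = 2 \<or> t = 4 \<or> t = 5 \<or> t = 6 \<or> t = 7" using assms by linarith
  ultimately show ?thesis by blast
qed

lemma leafed_C8_critical_shift:
  assumes u: "u < 8" and v: "v = (u + 3) mod 8"
  shows "packing_critical 4 (attach_leaves (cycle_graph 8) (\<lambda>w. if w \<in> {u, v} then 1 else 0))"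
proof (rule two_leafed_cycle_critical)
  have "int v mod 2 = (int u + 3) mod 2"
    unfolding v by (simp add: zmod_int mod_mod_cancel)
  then show "u mod 2 \<noteq> v mod 2" by presburger
  show "v < 8" using v by simp
  fix w assume w: "w < 8" "w \<noteq> u" "w \<noteq> v"
  have shift: "(i + (8 - u)) mod 8 = (j + (8 - u)) mod 8 \<longleftrightarrow> i = j" if "i < 8" "j < 8" for i j
    using that mod_add_neq[of i j 8 "8 - u"] mod_add_neq[of j i 8 "8 - u"]
    by (cases i j rule: linorder_cases) (auto simp: add.commute)
  have 0: "(u + (8 - u)) mod 8 = 0" using u by simp
  have "(v + (8 - u)) mod 8 = (u + 3 + (8 - u)) mod 8" unfolding v by (rule mod_add_left_eq)
  also have "u + 3 + (8 - u) = 3 + 8" using u by simp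
  finally have 3: "(v + (8 - u)) mod 8 = 3" by simp
  define t where "t = (w + (8 - u)) mod 8"
  have "t < 8" "t \<noteq> 0" "t \<noteq> 3"
    using shift[of w u] shift[of w v] 0 3 w u \<open>v < 8\<close> by (auto simp: t_def)
  then obtain d where d: "cyclic_packing 8 d" "\<forall>i<8. d i \<in> {1..4} \<and> (d i = 4 \<longleftrightarrow> i = t)"
    "d 0 \<noteq> 1" "d 3 \<noteq> 1"
    using C8_colorings by blast
  have "cyclic_packing 8 (\<lambda>i. d ((i + (8 - u)) mod 8))"
    by (rule cyclic_packing_rotate[OF d(1)]) simp
  moreover have "\<forall>i<8. d ((i + (8 - u)) mod 8) \<in> {1..4} \<and> (d ((i + (8 - u)) mod 8) = 4 \<longleftrightarrow> i = w)"
    using d(2) shift[OF _ w(1)] unfolding t_def by (metis mod_less_divisor zero_less_numeral)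
  ultimately show "\<exists>d. cyclic_packing 8 d \<and>
      (\<forall>i<8. d i \<in> {1..4} \<and> (d i = 4 \<longleftrightarrow> i = w)) \<and> d u \<noteq> 1 \<and> d v \<noteq> 1"
    using d(3,4) by (intro exI[of _ "\<lambda>i. d ((i + (8 - u)) mod 8)"]) (simp add: 0 3)
qed (use u in auto)

lemma C8_gdist_3:
  assumes "u < 8" "v < 8"
  shows "gdist (cycle_graph 8) u v = 3 \<longleftrightarrow> v = (u + 3) mod 8 \<or> u = (v + 3) mod 8"
proof -
  have "gdist (cycle_graph 8) u v = 3 \<longleftrightarrow>
      enat 2 < gdist (cycle_graph 8) u v \<and> \<not> enat 3 < gdist (cycle_graph 8) u v"
    by (cases "gdist (cycle_graph 8) u v") (auto simp: numeral_eq_enat)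
  also have "\<dots> \<longleftrightarrow> v = (u + 3) mod 8 \<or> u = (v + 3) mod 8"
  proof -
    have le3: "k \<le> 3 \<longleftrightarrow> k = 0 \<or> k = 1 \<or> k = 2 \<or> k = 3" and le2: "k \<le> 2 \<longleftrightarrow> k = 0 \<or> k = 1 \<or> k = 2"
      for k :: nat by auto
    have less8: "x < 8 \<longleftrightarrow> x \<in> {0, 1, 2, 3, 4, 5, 6, 7}" for x :: nat by auto
    show ?thesis
      unfolding cycle_gdist_greater_iff[OF assms] le2 le3
      using assms unfolding less8 by (elim insertE emptyE) simp_all
  qed
  finally show ?thesis .
qed

theorem leafed_C8_critical:
  assumes "u < 8" "v < 8" "gdist (cycle_graph 8) u v = 3"
  shows "packing_critical 4 (attach_leaves (cycle_graph 8) (\<lambda>w. if w \<in> {u, v} then 1 else 0))"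
  using assms(3) leafed_C8_critical_shift[OF assms(1), of v]
    leafed_C8_critical_shift[OF assms(2), of u, unfolded insert_commute[of v u "{}"]]
  unfolding C8_gdist_3[OF assms(1,2)] by blast

text \<open>If 4 divides \<open>n\<close>, leaves in both parity classes already prevent a 3-colouring, so that by
  criticality there is exactly one in each class. If the cycle is long, one of the two arcs between
  them leaves room for deleting a cycle vertex far away from the other arc.\<close>

theorem leafed_cycle_critical_cases:
  assumes n: "3 \<le> n" and crit: "packing_critical 4 (attach_leaves (cycle_graph n) l)"
  obtains (cycle) "5 \<le> n" "n mod 4 \<noteq> 0" "\<And>v. v < n \<Longrightarrow> l v = 0"
    | (net) "n = 3" "\<And>v. v < n \<Longrightarrow> l v = 1"
    | (C4) u v where "n = 4" "u < n" "v < n" "{u, v} \<in> edges (cycle_graph 4)"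
        "\<And>w. w < n \<Longrightarrow> l w = (if w \<in> {u, v} then 1 else 0)"
    | (C8) u v where "n = 8" "u < n" "v < n" "gdist (cycle_graph 8) u v = 3"
        "\<And>w. w < n \<Longrightarrow> l w = (if w \<in> {u, v} then 1 else 0)"
proof -
  let ?H = "attach_leaves (cycle_graph n)"
  have del: "packing_colorable (delete_vertex (?H l) x) 3" if "x \<in> verts (?H l)" for x
    using crit that by (simp add: packing_critical_4_iff finite_verts_leafed_cycle)
  have not3: "\<not> packing_colorable (?H l) 3"
    using crit by (simp add: packing_critical_4_iff finite_verts_leafed_cycle)
  have leaf: "packing_colorable (?H (l(v := l v - 1))) 3" if "v < n" "0 < l v" for v
    using del[of "(v, l v)"] that by (simp add: verts_attach_cycle delete_last_leaf)
  show thesis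
  proof (cases "n = 3")
    case True
    have "l v = 1" if v: "v < n" for v
    proof (rule ccontr)
      assume neq: "l v \<noteq> 1"
      have pos: "0 < l w" if "w < 3" for w
        using not3 that unfolding True leafed_triangle_3_colorable_iff by auto
      then have "0 < l v" using v True by simp
      then obtain w where "w < 3" "(l(v := l v - 1)) w = 0"
        using leaf[OF v] unfolding True leafed_triangle_3_colorable_iff by blast
      moreover have "(l(v := l v - 1)) v \<noteq> 0" using neq \<open>0 < l v\<close> by simp
      ultimately have "w \<noteq> v" "l w = 0" by (auto split: if_splits)
      then show False using pos[of w] \<open>w < 3\<close> by simp
    qed
    with True show thesis by (rule net)
  next
    case False
    then have n4: "4 \<le> n" using n by simp
    note col = leafed_cycle_3_colorable_iff[OF n4]
    show thesis
    proof (cases "4 dvd n")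
      case False
      then have "l v = 0" if "v < n" for v
        using leaf[OF that] False unfolding col by blast
      moreover have "n mod 4 \<noteq> 0" using False by (simp add: dvd_eq_mod_eq_0)
      moreover have "n \<noteq> 4" using False by auto
      then have "5 \<le> n" using n4 by linarith
      ultimately show thesis using cycle by blast
    next
      case True
      then have no: "\<exists>v<n. v mod 2 = r \<and> 0 < l v" if "r < 2" for r
      proof -
        have "\<not> (\<forall>v<n. v mod 2 = r \<longrightarrow> l v = 0)"
          using not3 True that unfolding col by blast
        then show ?thesis by auto
      qed
      obtain u where u: "u < n" "u mod 2 = 0" "0 < l u" using no[of 0] by auto
      obtain v where v: "v < n" "v mod 2 = 1" "0 < l v" using no[of 1] by auto
      have l: "l w = (if w \<in> {u, v} then 1 else 0)" if w: "w < n" for w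
      proof (rule ccontr)
        assume neq: "l w \<noteq> (if w \<in> {u, v} then 1 else 0)"
        then have "0 < l w" using u(3) v(3) by (auto split: if_splits)
        then obtain r where r: "r < 2" "\<And>x. \<lbrakk>x < n; x mod 2 = r\<rbrakk> \<Longrightarrow> (l(w := l w - 1)) x = 0"
          using leaf[OF w] unfolding col by blast
        have "(l(w := l w - 1)) u \<noteq> 0" "(l(w := l w - 1)) v \<noteq> 0"
          using u(3) v(3) neq by (auto split: if_splits)
        moreover have "r = u mod 2 \<or> r = v mod 2" using r(1) u(2) v(2) by linarith
        ultimately show False using r(2)[of u] r(2)[of v] u(1) v(1) by auto
      qed
      have arc: "n < d + 6" if "a < n" "0 < l a" "0 < l ((a + d) mod n)" "odd d" for a d
      proof (rule ccontr)
        assume "\<not> n < d + 6"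
        then have "\<not> packing_colorable (delete_vertex (?H l) ((a + n - 3) mod n, 0)) 3"
          using delete_far_cycle_vertex_not_3_colorable[OF n4 that] by simp
        then show False using del n4 by (simp add: verts_attach_cycle)
      qed
      define d where "d = (v + n - u) mod n"
      have "even n" using True by auto
      have "u + (v + n - u) = v + n" "odd v" "even u" using u v by (simp_all add: odd_iff_mod_2_eq_one even_iff_mod_2_eq_zero)
      then have "odd (v + n - u)" using \<open>even n\<close> by (metis even_add)
      then have odd: "odd d" "d < n"
        using \<open>even n\<close> n4 by (simp_all add: d_def dvd_mod_iff)
      then have "odd (n - d)" using \<open>even n\<close> by simp
      have "(u + d) mod n = (u + (v + n - u)) mod n" unfolding d_def by (rule mod_add_right_eq)
      also have "u + (v + n - u) = v + n" using u by simp
      finally have ud: "(u + d) mod n = v" using v by simp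
      have "(v + (n - d)) mod n = (u + d + (n - d)) mod n" unfolding ud[symmetric] by (rule mod_add_left_eq)
      also have "u + d + (n - d) = u + n" using odd by simp
      finally have vd: "(v + (n - d)) mod n = u" using u by simp
      have "n < d + 6" using arc[of u d] u v ud odd by simp
      have "n < n - d + 6" using arc[of v "n - d"] u v vd \<open>odd (n - d)\<close> by simp
      then have "d < 6" using odd by simp
      obtain k where k: "n = 4 * k" using True by blast
      have "k = 1 \<or> k = 2" using \<open>n < d + 6\<close> \<open>d < 6\<close> n4 k by linarith
      then have "n = 4 \<or> n = 8" using k by auto
      then show thesis
      proof
        assume 4: "n = 4"
        then have "u = 0 \<or> u = 2" "v = 1 \<or> v = 3" using u(1,2) v(1,2) by presburger+
        then have "{u, v} \<in> edges (cycle_graph 4)"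
          by (elim disjE) (simp_all add: cycle_graph_edge_iff)
        then show thesis using C4 4 u v l by blast
      next
        assume 8: "n = 8"
        then have "d = 3 \<or> d = 4 \<or> d = 5" using \<open>n < d + 6\<close> \<open>d < 6\<close> by linarith
        then have "d = 3 \<or> d = 5" using odd by auto
        then have "gdist (cycle_graph 8) u v = 3"
          using u v ud vd 8 by (auto simp: C8_gdist_3)
        then show thesis using C8 8 u v l by blast
      qed
    qed
  qed
qed


lemma attach_no_leaves_iso: "attach_leaves (cycle_graph n) (\<lambda>_. 0) \<cong>\<^sub>g cycle_graph n"
  unfolding graph_iso_def
proof (intro exI[of _ fst] conjI)
  show "bij_betw fst (verts (attach_leaves (cycle_graph n) (\<lambda>_. 0))) (verts (cycle_graph n))"
    by (rule bij_betw_byWitness[where f' = "\<lambda>v. (v, 0)"]) (auto simp: verts_attach_cycle)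
qed (auto simp: verts_attach_cycle attach_leaves_edge_iff)

lemma cycle_graph_3_eq: "cycle_graph 3 = complete_graph 3"
proof -
  have edges: "edges (cycle_graph 3) = {{0, 1}, {1, 2}, {2, 0}}"
  proof -
    have "edges (cycle_graph 3) = (\<lambda>i. {i, Suc i mod 3}) ` {0, 1, 2}"
      by (auto simp: cycle_graph_def less_3_cases)
    then show ?thesis by (simp add: numeral_2_eq_2)
  qed
  have "e \<in> edges (cycle_graph 3) \<longleftrightarrow> e \<subseteq> {..<3} \<and> card e = 2" for e
  proof
    assume "e \<in> edges (cycle_graph 3)"
    then show "e \<subseteq> {..<3} \<and> card e = 2"
      unfolding edges by auto
  next
    assume e: "e \<subseteq> {..<3} \<and> card e = 2"
    then obtain u v where uv: "e = {u, v}" "u \<noteq> v" by (meson card_2_iff)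
    then have "u < 3" "v < 3" using e by auto
    then show "e \<in> edges (cycle_graph 3)"
      using uv(2) unfolding uv(1) edges less_3_cases by (elim disjE) (simp_all add: insert_commute)
  qed
  then have "edges (cycle_graph 3) = edges (complete_graph 3)"
    unfolding complete_graph_def by auto
  then show ?thesis
    by (intro ugraph.equality) (simp_all add: complete_graph_def)
qed

theorem theorem4p5:
  fixes G :: "'a ugraph"
  assumes "simple_graph G" and "leafed_cycle G"
  shows "packing_critical 4 G \<longleftrightarrow>
     (\<exists>n. n \<ge> 5 \<and> n mod 4 \<noteq> 0 \<and> G \<cong>\<^sub>g cycle_graph n) \<or>
     G \<cong>\<^sub>g net_graph \<or>
     (\<exists>u\<in>verts (cycle_graph 4). \<exists>v\<in>verts (cycle_graph 4).
        {u, v} \<in> edges (cycle_graph 4) \<and>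
        G \<cong>\<^sub>g attach_leaves (cycle_graph 4) (\<lambda>w. if w \<in> {u, v} then 1 else 0)) \<or>
     (\<exists>u\<in>verts (cycle_graph 8). \<exists>v\<in>verts (cycle_graph 8).
        gdist (cycle_graph 8) u v = 3 \<and>
        G \<cong>\<^sub>g attach_leaves (cycle_graph 8) (\<lambda>w. if w \<in> {u, v} then 1 else 0))"
    (is "_ \<longleftrightarrow> ?cycle \<or> ?net \<or> ?C4 \<or> ?C8")
proof
  have finite: "finite (verts G)" using assms(1) by (simp add: simple_graph_def)
  assume crit: "packing_critical 4 G"
  obtain n l where n: "3 \<le> n" and G: "G \<cong>\<^sub>g attach_leaves (cycle_graph n) l"
    using assms(2) unfolding leafed_cycle_def by blast
  have G_cong: "G \<cong>\<^sub>g attach_leaves (cycle_graph n) l'" if "\<And>v. v < n \<Longrightarrow> l v = l' v" for l'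
    using G attach_leaves_cong[of "cycle_graph n" l l'] that by simp
  have "packing_critical 4 (attach_leaves (cycle_graph n) l)"
    by (rule packing_critical_iso_imp[OF G finite crit])
  with n show "?cycle \<or> ?net \<or> ?C4 \<or> ?C8"
  proof (cases rule: leafed_cycle_critical_cases)
    case cycle
    have "G \<cong>\<^sub>g cycle_graph n"
      by (rule graph_iso_trans[OF G_cong attach_no_leaves_iso]) (rule cycle(3))
    then show ?thesis using cycle(1,2) by blast
  next
    case net
    have "G \<cong>\<^sub>g attach_leaves (cycle_graph n) (\<lambda>_. 1)"
      by (rule G_cong) (rule net(2))
    then have ?net unfolding net(1) net_graph_def cycle_graph_3_eq .
    then show ?thesis by blast
  next
    case (C4 u v)
    have "G \<cong>\<^sub>g attach_leaves (cycle_graph 4) (\<lambda>w. if w \<in> {u, v} then 1 else 0)"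
      using G_cong[OF C4(5)] unfolding C4(1) .
    moreover have "u \<in> verts (cycle_graph 4)" "v \<in> verts (cycle_graph 4)"
      using C4(1-3) by simp_all
    ultimately have ?C4 using C4(4) by blast
    then show ?thesis by blast
  next
    case (C8 u v)
    have "G \<cong>\<^sub>g attach_leaves (cycle_graph 8) (\<lambda>w. if w \<in> {u, v} then 1 else 0)"
      using G_cong[OF C8(5)] unfolding C8(1) .
    moreover have "u \<in> verts (cycle_graph 8)" "v \<in> verts (cycle_graph 8)"
      using C8(1-3) by simp_all
    ultimately have ?C8 using C8(4) by blast
    then show ?thesis by blast
  qed
next
  have critical_iso: "packing_critical 4 G"
    if "G \<cong>\<^sub>g attach_leaves (cycle_graph n) l" "packing_critical 4 (attach_leaves (cycle_graph n) l)"
    for n l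
    by (rule packing_critical_iso_imp[OF graph_iso_sym[OF that(1)] finite_verts_leafed_cycle that(2)])
  assume "?cycle \<or> ?net \<or> ?C4 \<or> ?C8"
  then consider "?cycle" | "?net" | "?C4" | "?C8" by blast
  then show "packing_critical 4 G"
  proof cases
    case 1
    then obtain n where n: "5 \<le> n" "n mod 4 \<noteq> 0" "G \<cong>\<^sub>g cycle_graph n" by blast
    show ?thesis
      by (rule critical_iso[OF graph_iso_trans[OF n(3) graph_iso_sym[OF attach_no_leaves_iso]]
            cycle_critical[OF n(1,2)]])
  next
    case 2
    then have "G \<cong>\<^sub>g attach_leaves (cycle_graph 3) (\<lambda>_. 1)"
      unfolding net_graph_def cycle_graph_3_eq .
    then show ?thesis by (rule critical_iso[OF _ leafed_triangle_critical])
  next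
    case 3
    then obtain u v where "{u, v} \<in> edges (cycle_graph 4)"
      "G \<cong>\<^sub>g attach_leaves (cycle_graph 4) (\<lambda>w. if w \<in> {u, v} then 1 else 0)" by blast
    then show ?thesis using critical_iso leafed_C4_critical by simp
  next
    case 4
    then obtain u v where "u < 8" "v < 8" "gdist (cycle_graph 8) u v = 3"
      "G \<cong>\<^sub>g attach_leaves (cycle_graph 8) (\<lambda>w. if w \<in> {u, v} then 1 else 0)"
      unfolding verts_cycle_graph by blast
    then show ?thesis using critical_iso leafed_C8_critical by simp
  qed
qed

end
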